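(* Let $\mathcal H$ be a real Hilbert space, $A:\mathcal H\rightrightarrows\mathcal H$ a maximal monotone operator, $\Phi:\mathcal H\to\mathbb R$ and $\Psi_1:\mathcal H\to\mathbb R$ convex differentiable functions, and $\Psi_2:\mathcal H\to\mathbb R\cup\{+\infty\}$ a proper lower-semicontinuous convex function, with $\min\Psi_1=\min\Psi_2=0$ and $C=\operatorname{Argmin}\Psi_1\cap\operatorname{Argmin}\Psi_2\neq\emptyset$. Let $(\lambda_n)_{n\ge1}$ and $(\beta_n)_{n\ge 1}$ be sequences of positive numbers. Assume: (i) $\mathbf T=A+\nabla\Phi+N_C$ is maximal monotone and $S=\mathbf T^{-1}(0)\neq\emptyset$; (ii) $\nabla\Phi$ is $L_\Phi$-Lipschitz-continuous and $\nabla\Psi_1$ is $L_{\Psi_1}$-Lipschitz-continuous; (iii) for each $z\in N_C(\mathcal H)$, $\sum_{n=1}^\infty\lambda_n\beta_n\left[(\Psi_1+\Psi_2)^*\left(\frac{z}{\beta_n}\right)-\sigma_C\left(\frac{z}{\beta_n}\right)\right]<\infty$; (iv) $\sum_{n=1}^\infty\lambda_n=+\infty$, $\sum_{n=1}^\infty L_\Phi\lambda_n^2<+\infty$, and $\limsup_{n\to\infty}(L_{\Psi_1}\lambda_n\beta_n)<2$. Let $(x_n)_{n\ge1}$ be a sequence generated by the splitting forward-backward penalty algorithm (SFBP), and set $$\tau_n=\sum_{k=1}^n\lambda_k,\qquad z_n=\frac1{\tau_n}\sum_{k=1}^n\lambda_kx_k,\qquad \widehat z_n=\frac1{\tau_n}\sum_{k=1}^n\lambda_kx_{k+1}.$$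 Then the sequence $(\widehat z_n)$ converges weakly to a point in $S$ as $n\to\infty$. If moreover $(\lambda_n)\in\ell^2$, then the sequence $(z_n)$ converges weakly to a point in $S$ as $n\to\infty$.
   Context: $N_C$ is the (outward) normal cone operator of the closed convex set $C$: $N_C(x)=\{x^*\in\mathcal H:\langle x^*,c-x\rangle\le0\ \forall c\in C\}$ if $x\in C$ and $N_C(x)=\emptyset$ otherwise; $N_C(\mathcal H)=\bigcup_{x\in\mathcal H}N_C(x)$ is its range. $\sigma_C(x^* )=\sup_{c\in C}\langle x^*,c\rangle$ is the support function of $C$. $F^*(x^* )=\sup_{y\in\mathcal H}\{\langle y,x^*\rangle-F(y)\}$ is the Fenchel conjugate of $F$. The case $L_\Phi=0$ (respectively $L_{\Psi_1}=0$) is allowed when $\Phi$ is affine (respectively $\Psi_1\equiv0$). A sequence $(x_n)$ is generated by (SFBP) if $x_1\in\mathcal H$ and, for all $n\ge1$, $$x_{n+1}=(I+\lambda_nA+\lambda_n\beta_n\partial\Psi_2)^{-1}\big(x_n-\lambda_n\nabla\Phi(x_n)-\lambda_n\beta_n\nabla\Psi_1(x_n)\big),$$ that is, $$\frac{x_n-x_{n+1}}{\lambda_n}-\nabla\Phi(x_n)-\beta_n\nabla\Psi_1(x_n)\in Ax_{n+1}+\beta_n\partial\Psi_2(x_{n+1}).$$ Existence of such a sequence is taken for granted. *)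

theory Defs
  imports "HOL-Analysis.Analysis"
begin

text \<open>Set-valued operators on \<open>\<H>\<close> are functions of type \<open>'a \<Rightarrow> 'a set\<close>; pointwise sums of operators use
  the Minkowski sum of \<^theory>\<open>HOL-Library.Set_Algebras\<close>, so they are empty as soon as one summand is.\<close>

definition monotone_op :: "('a::real_inner \<Rightarrow> 'a set) \<Rightarrow> bool" where
  "monotone_op A \<longleftrightarrow> (\<forall>x y. \<forall>u\<in>A x. \<forall>v\<in>A y. inner (x - y) (u - v) \<ge> 0)"

definition maximal_monotone :: "('a::real_inner \<Rightarrow> 'a set) \<Rightarrow> bool" where
  "maximal_monotone A \<longleftrightarrow>
     monotone_op A \<and> (\<forall>B. monotone_op B \<and> (\<forall>x. A x \<subseteq> B x) \<longrightarrow> B = A)"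

definition zeros :: "('a::real_inner \<Rightarrow> 'a set) \<Rightarrow> 'a set" where
  "zeros A = {x. 0 \<in> A x}"

definition normal_cone :: "'a::real_inner set \<Rightarrow> 'a \<Rightarrow> 'a set" where
  "normal_cone C x = (if x \<in> C then {u. \<forall>c\<in>C. inner u (c - x) \<le> 0} else {})"

definition support_fun :: "'a::real_inner set \<Rightarrow> 'a \<Rightarrow> ereal" where
  "support_fun C u = (SUP c\<in>C. ereal (inner u c))"

definition fenchel_conj :: "('a::real_inner \<Rightarrow> ereal) \<Rightarrow> 'a \<Rightarrow> ereal" where
  "fenchel_conj F u = (SUP y. ereal (inner y u) - F y)"

text \<open>For a proper function \<open>F\<close>, the set \<open>subdifferential F x\<close> is empty wherever \<open>F x = \<infinity>\<close>.\<close>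

definition subdifferential :: "('a::real_inner \<Rightarrow> ereal) \<Rightarrow> 'a \<Rightarrow> 'a set" where
  "subdifferential F x = {u. \<forall>y. F x + ereal (inner u (y - x)) \<le> F y}"

definition proper_fun :: "('a \<Rightarrow> ereal) \<Rightarrow> bool" where
  "proper_fun F \<longleftrightarrow> (\<forall>x. F x \<noteq> -\<infinity>) \<and> (\<exists>x. F x \<noteq> \<infinity>)"

definition lsc_fun :: "('a::topological_space \<Rightarrow> ereal) \<Rightarrow> bool" where
  "lsc_fun F \<longleftrightarrow> (\<forall>x. F x \<le> Liminf (at x) F)"

text \<open>Only used for functions that do not take the value \<open>-\<infinity>\<close>, so no \<open>\<infinity> - \<infinity>\<close> occurs on the right.\<close>

definition convex_ereal :: "('a::real_vector \<Rightarrow> ereal) \<Rightarrow> bool" where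
  "convex_ereal F \<longleftrightarrow> (\<forall>x y. \<forall>t::real. 0 < t \<and> t < 1 \<longrightarrow>
     F ((1 - t) *\<^sub>R x + t *\<^sub>R y) \<le> ereal (1 - t) * F x + ereal t * F y)"

definition Argmin :: "('a \<Rightarrow> 'b::order) \<Rightarrow> 'a set" where
  "Argmin f = {x. \<forall>y. f x \<le> f y}"

definition has_min :: "('a \<Rightarrow> 'b::order) \<Rightarrow> 'b \<Rightarrow> bool" where
  "has_min f m \<longleftrightarrow> m \<in> range f \<and> (\<forall>x. m \<le> f x)"

text \<open>The Riesz representative of the Frechet derivative; meaningful at points of differentiability
  of \<open>f\<close> when the space is complete.\<close>

definition gradient :: "('a::real_inner \<Rightarrow> real) \<Rightarrow> 'a \<Rightarrow> 'a" where
  "gradient f x = (THE D. GDERIV f x :> D)"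

definition weakly_converges :: "(nat \<Rightarrow> 'a::real_inner) \<Rightarrow> 'a \<Rightarrow> bool" where
  "weakly_converges X p \<longleftrightarrow> (\<forall>y. (\<lambda>n. inner (X n) y) \<longlonglongrightarrow> inner p y)"

text \<open>All sequences are indexed from 1; their value at 0 is irrelevant.\<close>

definition SFBP_sequence ::
  "('a::real_inner \<Rightarrow> 'a set) \<Rightarrow> ('a \<Rightarrow> real) \<Rightarrow> ('a \<Rightarrow> real) \<Rightarrow> ('a \<Rightarrow> ereal) \<Rightarrow>
   (nat \<Rightarrow> real) \<Rightarrow> (nat \<Rightarrow> real) \<Rightarrow> (nat \<Rightarrow> 'a) \<Rightarrow> bool" where
  "SFBP_sequence A \<Phi> \<Psi>1 \<Psi>2 lam \<beta> x \<longleftrightarrow>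
     (\<forall>n\<ge>1. (x n - x (n + 1)) /\<^sub>R lam n - gradient \<Phi> (x n) - \<beta> n *\<^sub>R gradient \<Psi>1 (x n)
        \<in> A (x (n + 1)) + (\<lambda>v. \<beta> n *\<^sub>R v) ` subdifferential \<Psi>2 (x (n + 1)))"

end

theory Submission
  imports Defs
begin

text \<open>The proof is a Fejer--Opial--Passty argument. For every pair \<open>w \<in> T u\<close>, with
  \<open>T = A + \<nabla>\<Phi> + N\<^sub>C\<close>, all late iterations satisfy, with a summable error \<open>e\<^sub>n\<close>,
  \<open>\<parallel>x\<^sub>n\<^sub>+\<^sub>1 - u\<parallel>\<^sup>2 + (\<theta>/2) \<parallel>x\<^sub>n - x\<^sub>n\<^sub>+\<^sub>1\<parallel>\<^sup>2 + 2 \<lambda>\<^sub>n \<langle>w, x\<^sub>n\<^sub>+\<^sub>1 - u\<rangle> \<le> \<parallel>x\<^sub>n - u\<parallel>\<^sup>2 + e\<^sub>n\<close>.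
  It comes from monotonicity of \<open>A\<close>, the subgradient inequality for \<open>\<Psi>2\<close> and cocoercivity of the two
  gradients (\<open>forward_backward_penalty_step\<close>). The strict bound on the penalized step sizes leaves
  room to keep a fraction \<open>\<theta>\<close> of the penalty \<open>\<lambda>\<^sub>n \<beta>\<^sub>n (\<Psi>1 + \<Psi>2)(x\<^sub>n\<^sub>+\<^sub>1)\<close> on the left. If \<open>p\<close> is the
  component of \<open>w\<close> in \<open>N\<^sub>C u\<close>, that penalty absorbs \<open>2 \<lambda>\<^sub>n \<langle>p, x\<^sub>n\<^sub>+\<^sub>1 - u\<rangle>\<close> at the price of the gap
  between conjugate and support function at \<open>(p/\<theta>)/\<beta>\<^sub>n\<close>; since \<open>p/\<theta>\<close> is still a normal vector, the
  gaps are summable with weights \<open>\<lambda>\<^sub>n \<beta>\<^sub>n\<close>, and \<open>2 \<theta>\<close> times the weighted gaps are the errors \<open>e\<^sub>n\<close>.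

  With \<open>w = 0\<close> the inequality says that the distances of \<open>x\<^sub>n\<close> to each zero of \<open>T\<close> converge. Summed
  over \<open>n\<close> and divided by \<open>\<tau>\<^sub>n \<rightarrow> \<infinity>\<close>, it says that each weak cluster point \<open>q\<close> of the averages satisfies
  \<open>\<langle>w, q - u\<rangle> \<le> 0\<close> for all \<open>w \<in> T u\<close>, so \<open>q\<close> is a zero by maximality. Two cluster points \<open>q\<close> and
  \<open>r\<close> agree because \<open>\<langle>x\<^sub>n, q - r\<rangle>\<close>, hence also its average, converges
  (\<open>passty_ergodic_convergence\<close>). This proves the claim for \<open>zhat\<close>; the two averages differ by at
  most \<open>\<tau>\<^sub>n\<inverse> \<Sum> \<lambda>\<^sub>k \<parallel>x\<^sub>k - x\<^sub>k\<^sub>+\<^sub>1\<parallel>\<close>, which vanishes when the step sizes are square summable, because the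
  increments always are.

  Completeness enters through one fact: decreasing closed convex sets meet if they contain points of
  bounded norm (\<open>decreasing_closed_convex_sets_meet\<close>). It yields the Riesz representation, hence the gradients,
  and it yields weak cluster points as common points of the closed convex hulls of the tails,
  which avoids the weak topology altogether.\<close>

section \<open>Decreasing closed convex sets and the Riesz representation\<close>

text \<open>The minimal norms of the sets increase to a finite limit. Points of almost minimal norm therefore
  form a Cauchy sequence, by the parallelogram law: the midpoint of two of them lies in the larger
  set, so it cannot be much shorter than either.\<close>

lemma decreasing_closed_convex_sets_meet:
  fixes K :: "nat \<Rightarrow> 'a::{real_inner,complete_space} set"
  assumes convex: "\<And>n. convex (K n)"
    and closed: "\<And>n. closed (K n)"
    and dec: "\<And>m n. m \<le> n \<Longrightarrow> K n \<subseteq> K m"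
    and bounded: "\<And>n. \<exists>y\<in>K n. norm y \<le> B"
  shows "\<exists>q. \<forall>n. q \<in> K n"
proof -
  define m where "m n = (INF y\<in>K n. (norm y)\<^sup>2)" for n
  have m_le: "m n \<le> (norm y)\<^sup>2" if "y \<in> K n" for n y
    unfolding m_def by (rule cINF_lower[OF _ that]) (auto intro!: bdd_belowI[where m=0])
  have "m n \<le> B\<^sup>2" for n
    using bounded[of n] m_le[of _ n] by (meson order_trans norm_ge_zero power_mono)
  moreover have "incseq m"
  proof (rule monoI)
    fix i j :: nat assume "i \<le> j"
    then have "K j \<subseteq> K i" by (rule dec)
    then show "m i \<le> m j"
      unfolding m_def using bounded[of j]
      by (intro cINF_superset_mono) (auto intro!: bdd_belowI[where m=0])
  qed
  ultimately obtain L where L: "m \<longlonglongrightarrow> L" and m_le_L: "\<And>n. m n \<le> L"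
    using incseq_convergent[of m "B\<^sup>2"] by blast
  have "\<exists>y. y \<in> K n \<and> (norm y)\<^sup>2 < m n + 1 / Suc n" for n
  proof -
    have "(INF y\<in>K n. (norm y)\<^sup>2) < m n + 1 / Suc n" by (simp add: m_def)
    then show ?thesis
      using bounded[of n] by (subst (asm) cINF_less_iff) (auto intro!: bdd_belowI[where m=0])
  qed
  then obtain y where y_in: "\<And>n. y n \<in> K n" and y_norm: "\<And>n. (norm (y n))\<^sup>2 < m n + 1 / Suc n"
    by metis
  have near: "(norm (y n - y k))\<^sup>2 \<le> 2 * (L - m n) + 4 / Suc n" if "n \<le> k" for n k
  proof -
    have "(1/2) *\<^sub>R y n + (1/2) *\<^sub>R y k \<in> K n"
      using convex[of n] y_in[of n] y_in[of k] dec[OF that] by (auto simp: convex_def)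
    then have "m n \<le> (norm ((1/2) *\<^sub>R y n + (1/2) *\<^sub>R y k))\<^sup>2" by (rule m_le)
    then have "4 * m n \<le> (norm (y n + y k))\<^sup>2"
      by (simp add: power2_norm_eq_inner inner_simps inner_commute)
    moreover have "(norm (y n - y k))\<^sup>2 + (norm (y n + y k))\<^sup>2 = 2 * (norm (y n))\<^sup>2 + 2 * (norm (y k))\<^sup>2"
      by (simp add: power2_norm_eq_inner inner_simps inner_commute)
    moreover have "1 / real (Suc k) \<le> 1 / real (Suc n)" using that by (simp add: frac_le)
    ultimately show ?thesis
      using y_norm[of n] y_norm[of k] m_le_L[of k] by simp
  qed
  have "(\<lambda>n. 2 * (L - m n) + 4 * inverse (real (Suc n))) \<longlonglongrightarrow> 2 * (L - L) + 4 * 0"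
    by (intro tendsto_intros L LIMSEQ_inverse_real_of_nat)
  then have small: "(\<lambda>n. 2 * (L - m n) + 4 / real (Suc n)) \<longlonglongrightarrow> 0" by (simp add: divide_inverse)
  have "Cauchy y"
  proof (rule CauchyI')
    fix e :: real assume "e > 0"
    then have "\<forall>\<^sub>F n in sequentially. 2 * (L - m n) + 4 / real (Suc n) < e\<^sup>2"
      using order_tendstoD(2)[OF small, of "e\<^sup>2"] by simp
    then obtain M where M: "\<And>n. n \<ge> M \<Longrightarrow> 2 * (L - m n) + 4 / real (Suc n) < e\<^sup>2"
      by (auto simp: eventually_sequentially)
    show "\<exists>M. \<forall>m\<ge>M. \<forall>n>m. dist (y m) (y n) < e"
    proof (intro exI[of _ M] allI impI)
      fix i j assume "M \<le> i" "i < j"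
      then have "(norm (y i - y j))\<^sup>2 < e\<^sup>2" using near[of i j] M[of i] by simp
      then show "dist (y i) (y j) < e"
        using \<open>e > 0\<close> by (simp add: dist_norm power_less_imp_less_base)
    qed
  qed
  then obtain q where q: "y \<longlonglongrightarrow> q" using Cauchy_convergent convergent_def by blast
  have "q \<in> K n" for n
    using dec y_in
    by (intro Lim_in_closed_set[OF closed[of n] _ _ q])
      (auto simp: eventually_sequentially intro!: exI[of _ n])
  then show ?thesis by blast
qed

text \<open>The hyperplane \<open>f = 1\<close> has a point \<open>q\<close> of minimal norm, obtained as a common point of its
  intersections with shrinking balls. Minimality makes \<open>q\<close> orthogonal to the kernel of \<open>f\<close>, so \<open>f\<close> is
  the inner product with a multiple of \<open>q\<close>.\<close>

lemma riesz_representation: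
  fixes f :: "'a::{real_inner,complete_space} \<Rightarrow> real"
  assumes "bounded_linear f"
  shows "\<exists>D. \<forall>h. f h = inner h D"
proof (cases "\<forall>h. f h = 0")
  case True
  then show ?thesis by (intro exI[of _ 0]) simp
next
  case False
  interpret f: bounded_linear f by (rule assms)
  obtain h1 where h1: "f h1 = 1"
    using False by (metis f.scaleR nonzero_eq_divide_eq real_scaleR_def divide_inverse_commute mult.commute right_inverse)
  define m where "m = (INF h\<in>{h. f h = 1}. norm h)"
  define K where "K n = {h. f h = 1} \<inter> cball 0 (m + 1 / Suc n)" for n
  have m_le: "m \<le> norm h" if "f h = 1" for h
    unfolding m_def using that by (intro cINF_lower) (auto intro!: bdd_belowI[where m=0])
  have "\<exists>h\<in>K n. norm h \<le> m + 1" for n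
  proof -
    have "(INF h\<in>{h. f h = 1}. norm h) < m + 1 / Suc n" by (simp add: m_def)
    then obtain h where "f h = 1" "norm h < m + 1 / Suc n"
      using h1 by (subst (asm) cINF_less_iff) (auto intro!: bdd_belowI[where m=0])
    moreover have "m + 1 / real (Suc n) \<le> m + 1" by simp
    ultimately have "h \<in> K n \<and> norm h \<le> m + 1"
      unfolding K_def Int_iff mem_Collect_eq mem_cball_0 by linarith
    then show ?thesis by blast
  qed
  moreover have "convex (K n)" for n
    unfolding K_def by (intro convex_Int convex_cball) (auto simp: convex_def f.add f.scaleR)
  moreover have "closed (K n)" for n
    unfolding K_def by (intro closed_Int closed_cball closed_Collect_eq)
      (auto intro!: continuous_intros linear_continuous_on assms)
  moreover have "K n \<subseteq> K k" if "k \<le> n" for k n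
    unfolding K_def using that by (intro Int_mono subset_refl subset_cball add_left_mono frac_le) auto
  ultimately obtain q where q: "\<And>n. q \<in> K n"
    using decreasing_closed_convex_sets_meet[of K] by metis
  have fq: "f q = 1" using q[of 0] by (simp add: K_def)
  have "norm q \<le> m"
  proof (rule field_le_epsilon)
    fix e :: real assume "e > 0"
    then obtain n where "1 / real (Suc n) < e" using nat_approx_posE by blast
    then show "norm q \<le> m + e" using q[of n] by (simp add: K_def)
  qed
  have orth: "inner h q = 0" if h: "f h = 0" for h
  proof (rule ccontr)
    assume ne: "inner h q \<noteq> 0"
    then have "h \<noteq> 0" by auto
    define t where "t = inner h q / inner h h"
    have "f (q - t *\<^sub>R h) = 1" using h fq by (simp add: f.diff f.scaleR)
    then have "norm q \<le> norm (q - t *\<^sub>R h)" using m_le \<open>norm q \<le> m\<close> by fastforce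
    then have "(norm q)\<^sup>2 \<le> (norm (q - t *\<^sub>R h))\<^sup>2" by simp
    also have "\<dots> = (norm q)\<^sup>2 - (inner h q)\<^sup>2 / inner h h"
      using \<open>h \<noteq> 0\<close> unfolding power2_norm_eq_inner t_def
      by (simp add: inner_diff_left inner_diff_right inner_commute power2_eq_square)
    finally have "(inner h q)\<^sup>2 / inner h h \<le> 0" by simp
    moreover have "(inner h q)\<^sup>2 / inner h h > 0" using ne \<open>h \<noteq> 0\<close> by simp
    ultimately show False by linarith
  qed
  have "q \<noteq> 0" using fq f.zero by auto
  have "f h = inner h (q /\<^sub>R inner q q)" for h
  proof -
    have "inner (h - f h *\<^sub>R q) q = 0" by (rule orth) (simp add: f.diff f.scaleR fq)
    then show ?thesis using \<open>q \<noteq> 0\<close> by (simp add: inner_simps field_simps)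
  qed
  then show ?thesis by blast
qed

section \<open>Gradients of smooth convex functions\<close>

text \<open>The Riesz representation provides the existence that the definite description in the definition of
  \<^const>\<open>gradient\<close> needs.\<close>

lemma GDERIV_gradient:
  fixes f :: "'a::{real_inner,complete_space} \<Rightarrow> real"
  assumes "f differentiable (at y)"
  shows "GDERIV f y :> gradient f y"
proof -
  obtain f' where f': "(f has_derivative f') (at y)" using assms by (auto simp: differentiable_def)
  obtain D where D: "f' = (\<lambda>h. inner h D)"
    using riesz_representation[OF has_derivative_bounded_linear[OF f']] by blast
  have "\<exists>!D. GDERIV f y :> D"
  proof (rule ex1I[of _ D])
    show "GDERIV f y :> D" using f' D by (simp add: gderiv_def)
  next
    fix E assume "GDERIV f y :> E"
    then have "(\<lambda>h. inner h E) = (\<lambda>h. inner h D)"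
      using f' D has_derivative_unique unfolding gderiv_def by blast
    then have "inner (E - D) E = inner (E - D) D" by metis
    then have "inner (E - D) (E - D) = 0" by (simp only: inner_diff_right)
    then show "E = D" by simp
  qed
  then show ?thesis unfolding gradient_def by (rule theI')
qed

lemma GDERIV_along_line:
  fixes f :: "'a::real_inner \<Rightarrow> real"
  assumes "GDERIV f (x + t *\<^sub>R d) :> D"
  shows "((\<lambda>t. f (x + t *\<^sub>R d)) has_real_derivative inner D d) (at t)"
proof -
  have "((\<lambda>t. x + t *\<^sub>R d) has_derivative (\<lambda>t. t *\<^sub>R d)) (at t)"
    by (auto intro!: derivative_eq_intros)
  from has_derivative_compose[OF this, of f "\<lambda>h. inner h D"] assms show ?thesis
    by (simp add: gderiv_def has_field_derivative_def inner_commute mult_commute_abs)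
qed

lemma convex_gradient_inequality:
  fixes f :: "'a::{real_inner,complete_space} \<Rightarrow> real"
  assumes convex: "convex_on UNIV f" and diff: "\<And>y. f differentiable (at y)"
  shows "f x + inner (gradient f x) (y - x) \<le> f y"
proof -
  define g where "g t = f (x + t *\<^sub>R (y - x))" for t
  have "convex_on UNIV g"
  proof (intro convex_onI convex_UNIV)
    fix t a b :: real assume t: "0 < t" "t < 1"
    have "x + ((1 - t) *\<^sub>R a + t *\<^sub>R b) *\<^sub>R (y - x)
        = (1 - t) *\<^sub>R (x + a *\<^sub>R (y - x)) + t *\<^sub>R (x + b *\<^sub>R (y - x))"
      by (simp add: algebra_simps)
    then show "g ((1 - t) *\<^sub>R a + t *\<^sub>R b) \<le> (1 - t) * g a + t * g b"
      unfolding g_def using convex_onD[OF convex, of t] t by simp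
  qed
  moreover have "(g has_real_derivative inner (gradient f x) (y - x)) (at 0)"
    unfolding g_def by (rule GDERIV_along_line) (simp add: GDERIV_gradient diff)
  ultimately show ?thesis
    using convex_on_imp_above_tangent[of UNIV g 0 1 "inner (gradient f x) (y - x)"] by (simp add: g_def)
qed

text \<open>Along the segment from \<open>x\<close> to \<open>y\<close>, the function minus the quadratic on the right-hand side has
  nonpositive derivative.\<close>

lemma descent_lemma:
  fixes f :: "'a::{real_inner,complete_space} \<Rightarrow> real"
  assumes diff: "\<And>y. f differentiable (at y)" and lip: "L-lipschitz_on UNIV (gradient f)"
  shows "f y \<le> f x + inner (gradient f x) (y - x) + L / 2 * (norm (y - x))\<^sup>2"
proof -
  define d where "d = y - x"
  define g where "g t = f (x + t *\<^sub>R d) - t * inner (gradient f x) d - L / 2 * t\<^sup>2 * (norm d)\<^sup>2" for t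
  have "g 1 \<le> g 0"
  proof (rule DERIV_nonpos_imp_nonincreasing[of 0 1 g])
    fix t :: real assume t: "0 \<le> t" "t \<le> 1"
    let ?D = "inner (gradient f (x + t *\<^sub>R d)) d - inner (gradient f x) d - L * t * (norm d)\<^sup>2"
    have "(g has_real_derivative ?D) (at t)"
      unfolding g_def
      by (auto intro!: derivative_eq_intros GDERIV_along_line GDERIV_gradient diff)
    moreover have "inner (gradient f (x + t *\<^sub>R d) - gradient f x) d \<le> L * t * (norm d)\<^sup>2"
    proof -
      have "inner (gradient f (x + t *\<^sub>R d) - gradient f x) d
          \<le> norm (gradient f (x + t *\<^sub>R d) - gradient f x) * norm d" by (rule norm_cauchy_schwarz)
      also have "\<dots> \<le> (L * (t * norm d)) * norm d"
        using lipschitz_onD[OF lip, of "x + t *\<^sub>R d" x] t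
        by (intro mult_right_mono) (simp_all add: dist_norm)
      finally show ?thesis by (simp add: power2_eq_square mult.assoc)
    qed
    ultimately show "\<exists>D. (g has_real_derivative D) (at t) \<and> D \<le> 0"
      by (intro exI[of _ ?D]) (simp add: inner_diff_left)
  qed simp
  then show ?thesis by (simp add: g_def d_def)
qed

text \<open>The Baillon--Haddad inequality. Each half, stated as \<open>half\<close>, compares the tangent at \<open>a\<close> with the
  quadratic upper bound at \<open>b\<close> in the point \<open>c\<close> where the difference of the two is
  extremal; adding it to itself with the roles of the points exchanged gives the claim.\<close>

lemma gradient_cocoercive:
  fixes f :: "'a::{real_inner,complete_space} \<Rightarrow> real"
  assumes convex: "convex_on UNIV f" and diff: "\<And>y. f differentiable (at y)"
    and lip: "L-lipschitz_on UNIV (gradient f)"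
  shows "(norm (gradient f x - gradient f u))\<^sup>2 \<le> L * inner (gradient f x - gradient f u) (x - u)"
proof (cases "L = 0")
  case True
  then show ?thesis using lipschitz_onD[OF lip, of x u] by simp
next
  case False
  then have "L > 0" using lipschitz_on_nonneg[OF lip] by simp
  have half: "f a + inner (gradient f a) (b - a) + (norm (gradient f a - gradient f b))\<^sup>2 / (2 * L) \<le> f b"
    for a b
  proof -
    define g where "g = gradient f a - gradient f b"
    \<comment> \<open>The maximizer of the tangent at \<open>a\<close> minus the quadratic upper bound at \<open>b\<close>.\<close>
    define c where "c = b + g /\<^sub>R L"
    have "f a + inner (gradient f a) (c - a) \<le> f c"
      by (rule convex_gradient_inequality[OF convex diff])
    also have "f c \<le> f b + inner (gradient f b) (c - b) + L / 2 * (norm (c - b))\<^sup>2"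
      by (rule descent_lemma[OF diff lip])
    finally have "f a + inner (gradient f a) (b - a) + inner g (c - b) \<le> f b + L / 2 * (norm (c - b))\<^sup>2"
      by (simp add: g_def inner_simps)
    moreover have "inner g (c - b) = (norm g)\<^sup>2 / L" by (simp add: c_def power2_norm_eq_inner divide_inverse)
    moreover have "L / 2 * (norm (c - b))\<^sup>2 = (norm g)\<^sup>2 / (2 * L)"
      using \<open>L > 0\<close> by (simp add: c_def power_mult_distrib field_simps power2_eq_square)
    moreover have "(norm g)\<^sup>2 / L = 2 * ((norm g)\<^sup>2 / (2 * L))" by simp
    ultimately show ?thesis unfolding g_def by linarith
  qed
  have "2 * ((norm (gradient f x - gradient f u))\<^sup>2 / (2 * L)) \<le> inner (gradient f x - gradient f u) (x - u)"
    using half[of x u] half[of u x] by (simp add: inner_simps norm_minus_commute)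
  then show ?thesis using \<open>L > 0\<close> by (simp add: field_simps)
qed

text \<open>The form in which cocoercivity is used: the forward step evaluates the gradient at the old point
  \<open>x\<close> but is tested against the new point \<open>y\<close>, and the mismatch costs only a multiple of the squared
  increment. The case distinction covers affine \<open>f\<close>, where one cannot divide by \<open>L\<close>.\<close>

lemma gradient_three_point:
  fixes f :: "'a::{real_inner,complete_space} \<Rightarrow> real"
  assumes convex: "convex_on UNIV f" and diff: "\<And>y. f differentiable (at y)"
    and lip: "L-lipschitz_on UNIV (gradient f)"
  shows "inner (gradient f x - gradient f u) (u - y) \<le> L / 4 * (norm (x - y))\<^sup>2"
proof -
  define g where "g = gradient f x - gradient f u"
  have coco: "(norm g)\<^sup>2 \<le> L * inner g (x - u)"
    unfolding g_def by (rule gradient_cocoercive[OF convex diff lip])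
  show ?thesis
  proof (cases "L = 0")
    case True
    then show ?thesis using coco by (simp flip: g_def)
  next
    case False
    then have "L > 0" using lipschitz_on_nonneg[OF lip] by simp
    have "0 \<le> (norm (g - (L / 2) *\<^sub>R (x - y)))\<^sup>2" by simp
    also have "\<dots> = (norm g)\<^sup>2 - L * inner g (x - y) + L\<^sup>2 / 4 * (norm (x - y))\<^sup>2"
      unfolding power2_norm_eq_inner
      by (simp add: inner_diff_left inner_diff_right inner_commute power2_eq_square algebra_simps)
    also have "\<dots> \<le> L * inner g (x - u) - L * inner g (x - y) + L\<^sup>2 / 4 * (norm (x - y))\<^sup>2"
      using coco by simp
    also have "\<dots> = L * (L / 4 * (norm (x - y))\<^sup>2 - inner g (u - y))"
      by (simp add: inner_simps power2_eq_square algebra_simps)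
    finally show ?thesis using \<open>L > 0\<close> by (simp add: zero_le_mult_iff flip: g_def)
  qed
qed

lemma minimizer_gradient_zero:
  fixes f :: "'a::{real_inner,complete_space} \<Rightarrow> real"
  assumes "f differentiable (at u)" "\<And>y. f u \<le> f y"
  shows "gradient f u = 0"
proof -
  have "(f has_derivative (\<lambda>h. inner h (gradient f u))) (at u)"
    using GDERIV_gradient[OF assms(1)] by (simp add: gderiv_def)
  then have "(\<lambda>h. inner h (gradient f u)) = (\<lambda>h. 0)"
    using assms(2) by (intro differential_zero_maxmin[of u UNIV f]) auto
  then show ?thesis by (metis inner_eq_zero_iff)
qed

section \<open>Weak convergence of bounded sequences\<close>

text \<open>A substitute for weak sequential compactness. The point \<open>q\<close> lies in the closed convex hull of
  every tail of the sequence, so it inherits each closed half-space that eventually contains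
  the sequence. It need not be the weak limit of a subsequence, but this inheritance is all that the
  subsequent arguments use.\<close>

lemma weak_cluster_point_exists:
  fixes z :: "nat \<Rightarrow> 'a::{real_inner,complete_space}"
  assumes "bounded (range z)"
  shows "\<exists>q. \<forall>y b. (\<forall>\<^sub>F n in sequentially. inner (z n) y \<le> b) \<longrightarrow> inner q y \<le> b"
proof -
  define K where "K n = closure (convex hull (z ` {n..}))" for n
  obtain B where B: "\<And>n. norm (z n) \<le> B" using assms by (auto simp: bounded_iff)
  have "z n \<in> K n" for n
    unfolding K_def by (intro subsetD[OF closure_subset] hull_inc) auto
  then have "\<exists>y\<in>K n. norm y \<le> B" for n using B by blast
  moreover have "K n \<subseteq> K m" if "m \<le> n" for m n
    unfolding K_def using that by (intro closure_mono hull_mono image_mono) auto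
  moreover have "convex (K n)" "closed (K n)" for n unfolding K_def by simp_all
  ultimately obtain q where q: "\<And>n. q \<in> K n"
    using decreasing_closed_convex_sets_meet[of K B] by blast
  have "inner q y \<le> b" if ev: "\<forall>\<^sub>F n in sequentially. inner (z n) y \<le> b" for y b
  proof -
    obtain N where N: "\<And>n. n \<ge> N \<Longrightarrow> inner (z n) y \<le> b"
      using ev by (auto simp: eventually_sequentially)
    have "K N \<subseteq> {v. inner y v \<le> b}"
      unfolding K_def using N
      by (intro closure_minimal hull_minimal closed_halfspace_le convex_halfspace_le)
        (auto simp: inner_commute)
    then show ?thesis using q[of N] by (auto simp: inner_commute)
  qed
  then show ?thesis by blast
qed

text \<open>Opial's argument with the generalized cluster points above. If the sequence stayed away from a cluster
  point \<open>p\<close> in some direction along a subsequence, that subsequence would have a cluster point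
  \<open>q \<noteq> p\<close>, also in \<open>S\<close>. But \<open>\<langle>z\<^sub>n, q - p\<rangle>\<close> converges, and its limit has to be both \<open>\<langle>p, q - p\<rangle>\<close>
  and \<open>\<langle>q, q - p\<rangle>\<close>, which forces \<open>q = p\<close>.\<close>

lemma weak_convergence_opial:
  fixes z :: "nat \<Rightarrow> 'a::{real_inner,complete_space}"
  assumes bounded: "bounded (range z)"
    and cluster: "\<And>q. (\<And>y b. (\<forall>\<^sub>F n in sequentially. inner (z n) y \<le> b) \<Longrightarrow> inner q y \<le> b) \<Longrightarrow> q \<in> S"
    and conv: "\<And>q r. q \<in> S \<Longrightarrow> r \<in> S \<Longrightarrow> convergent (\<lambda>n. inner (z n) (q - r))"
  shows "\<exists>p\<in>S. weakly_converges z p"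
proof -
  have sub: "\<exists>q\<in>S. \<forall>y b. (\<forall>\<^sub>F n in sequentially. inner (z (r n)) y \<le> b) \<longrightarrow> inner q y \<le> b"
    if r: "strict_mono r" for r
  proof -
    have "bounded (range (z \<circ> r))" using bounded by (rule bounded_subset) auto
    then obtain q where
      q: "\<And>y b. \<forall>\<^sub>F n in sequentially. inner (z (r n)) y \<le> b \<Longrightarrow> inner q y \<le> b"
      using weak_cluster_point_exists[of "z \<circ> r"] by auto
    have "q \<in> S"
    proof (rule cluster)
      fix y b assume "\<forall>\<^sub>F n in sequentially. inner (z n) y \<le> b"
      then have "\<forall>\<^sub>F n in sequentially. inner (z (r n)) y \<le> b"
        by (rule eventually_subseq[OF r])
      then show "inner q y \<le> b" by (rule q)
    qed
    then show ?thesis using q by blast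
  qed
  have lim: "inner q y = l"
    if "(\<lambda>n. inner (z (r n)) y) \<longlonglongrightarrow> l"
      and q: "\<forall>y b. (\<forall>\<^sub>F n in sequentially. inner (z (r n)) y \<le> b) \<longrightarrow> inner q y \<le> b" for q r y l
  proof (rule antisym; rule field_le_epsilon)
    fix e :: real assume "e > 0"
    have "\<forall>\<^sub>F n in sequentially. inner (z (r n)) y < l + e"
      using that(1) \<open>e > 0\<close> by (intro order_tendstoD) auto
    then have "\<forall>\<^sub>F n in sequentially. inner (z (r n)) y \<le> l + e"
      by (rule eventually_mono) simp
    then show "inner q y \<le> l + e" using q by blast
    have "\<forall>\<^sub>F n in sequentially. l - e < inner (z (r n)) y"
      using that(1) \<open>e > 0\<close> by (intro order_tendstoD) auto
    then have "\<forall>\<^sub>F n in sequentially. inner (z (r n)) (- y) \<le> e - l"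
      by (rule eventually_mono) simp
    then have "inner q (- y) \<le> e - l" using q by blast
    then show "l \<le> inner q y + e" by simp
  qed
  obtain p where p: "p \<in> S"
    and p_cl: "\<forall>y b. (\<forall>\<^sub>F n in sequentially. inner (z n) y \<le> b) \<longrightarrow> inner p y \<le> b"
    using sub[of "\<lambda>n. n"] by (auto simp: strict_mono_def)
  have upper: "\<forall>\<^sub>F n in sequentially. inner (z n) y < inner p y + e" if "e > 0" for y e
  proof (rule ccontr)
    assume "\<not> ?thesis"
    then have "\<exists>\<^sub>F n in sequentially. inner p y + e \<le> inner (z n) y"
      by (simp add: not_eventually not_less)
    then have inf: "infinite {n. inner p y + e \<le> inner (z n) y}"
      by (simp add: frequently_cofinite flip: cofinite_eq_sequentially)
    define r where "r = enumerate {n. inner p y + e \<le> inner (z n) y}"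
    have r: "strict_mono r" unfolding r_def by (rule strict_mono_enumerate[OF inf])
    have far: "inner (z (r n)) (- y) \<le> - (inner p y + e)" for n
      using enumerate_in_set[OF inf, of n] by (simp add: r_def)
    obtain q where q: "q \<in> S"
      and q_cl: "\<forall>y b. (\<forall>\<^sub>F n in sequentially. inner (z (r n)) y \<le> b) \<longrightarrow> inner q y \<le> b"
      using sub[OF r] by blast
    have "inner q (- y) \<le> - (inner p y + e)" using q_cl far by (blast intro: always_eventually)
    then have "inner q y \<ge> inner p y + e" by simp
    obtain l where l: "(\<lambda>n. inner (z n) (q - p)) \<longlonglongrightarrow> l"
      using conv[OF q p] by (auto simp: convergent_def)
    have "inner p (q - p) = l" using lim[of "\<lambda>n. n"] l p_cl by blast
    moreover have "inner q (q - p) = l"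
      using lim[OF LIMSEQ_subseq_LIMSEQ[OF l r, unfolded comp_def]] q_cl by blast
    ultimately have "inner (q - p) (q - p) = 0" by (simp add: inner_diff_left)
    then have "q = p" by simp
    with \<open>inner q y \<ge> inner p y + e\<close> that show False by simp
  qed
  have "(\<lambda>n. inner (z n) y) \<longlonglongrightarrow> inner p y" for y
  proof (rule order_tendstoI)
    fix a assume "a < inner p y"
    then have "\<forall>\<^sub>F n in sequentially. inner (z n) (- y) < inner p (- y) + (inner p y - a)"
      by (intro upper) simp
    then show "\<forall>\<^sub>F n in sequentially. a < inner (z n) y" by (rule eventually_mono) simp
  next
    fix a assume "inner p y < a"
    then have "\<forall>\<^sub>F n in sequentially. inner (z n) y < inner p y + (a - inner p y)"
      by (intro upper) simp
    then show "\<forall>\<^sub>F n in sequentially. inner (z n) y < a" by simp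
  qed
  then show ?thesis using p unfolding weakly_converges_def by blast
qed

lemma weakly_converges_norm_close:
  assumes "weakly_converges X p" and "(\<lambda>n. Y n - X n) \<longlonglongrightarrow> 0"
  shows "weakly_converges Y p"
  unfolding weakly_converges_def
proof
  fix y
  have "(\<lambda>n. inner (X n) y + inner (Y n - X n) y) \<longlonglongrightarrow> inner p y + inner 0 y"
    using assms(1) unfolding weakly_converges_def
    by (intro tendsto_add tendsto_inner[OF assms(2) tendsto_const]) simp
  then show "(\<lambda>n. inner (Y n) y) \<longlonglongrightarrow> inner p y" by (simp add: inner_diff_left)
qed

section \<open>Real sequences with summable errors and weighted means\<close>

text \<open>An inequality that holds eventually with summable error holds everywhere with another summable error;
  this removes the starting index from all later sums.\<close>

lemma summable_error_everywhere:
  fixes c d e :: "nat \<Rightarrow> real"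
  assumes "\<forall>\<^sub>F n in sequentially. c n \<le> d n + e n" "summable e" "\<And>n. e n \<ge> 0"
  shows "\<exists>e'. summable e' \<and> (\<forall>n. 0 \<le> e' n) \<and> (\<forall>n. c n \<le> d n + e' n)"
proof -
  define e' where "e' n = (if c n \<le> d n + e n then e n else \<bar>c n - d n\<bar>)" for n
  have "\<forall>\<^sub>F n in sequentially. e' n = e n"
    using assms(1) by (rule eventually_mono) (simp add: e'_def)
  then have "summable e'" using summable_cong[of e' e] assms(2) by blast
  moreover have "0 \<le> e' n" "c n \<le> d n + e' n" for n using assms(3)[of n] by (auto simp: e'_def)
  ultimately show ?thesis by blast
qed

text \<open>Subtracting the partial sums of the errors leaves a decreasing sequence that is bounded below.\<close>

lemma quasi_decreasing_bounded_convergent: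
  fixes a e :: "nat \<Rightarrow> real"
  assumes step: "\<And>n. a (Suc n) \<le> a n + e n" and nonneg: "\<And>n. 0 \<le> a n"
    and e: "summable e" "\<And>n. 0 \<le> e n"
  shows "convergent a"
proof -
  define b where "b n = a n - (\<Sum>k<n. e k)" for n
  have "b (Suc n) \<le> b n" for n using step[of n] by (simp add: b_def)
  then have "decseq b" by (simp add: decseq_SucI)
  moreover have "- suminf e \<le> b n" for n
    using nonneg[of n] sum_le_suminf[OF e(1), of "{..<n}"] e(2) by (simp add: b_def)
  ultimately have "convergent b" using decseq_convergent[of b "- suminf e"] convergent_def by metis
  moreover have "convergent (\<lambda>n. \<Sum>k<n. e k)" using e(1) by (simp add: summable_iff_convergent)
  ultimately have "convergent (\<lambda>n. b n + (\<Sum>k<n. e k))" by (rule convergent_add)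
  then show ?thesis by (simp add: b_def)
qed

lemma telescoping_partial_sums_bounded:
  fixes a c e :: "nat \<Rightarrow> real"
  assumes step: "\<And>n. a (Suc n) + c n \<le> a n + e n" and nonneg: "\<And>n. 0 \<le> a n"
    and e: "summable e" "\<And>n. 0 \<le> e n"
  shows "(\<Sum>k<n. c k) \<le> a 0 + suminf e"
proof -
  have "a n + (\<Sum>k<n. c k) \<le> a 0 + (\<Sum>k<n. e k)"
  proof (induction n)
    case (Suc n)
    then show ?case using step[of n] by simp
  qed simp
  also have "(\<Sum>k<n. e k) \<le> suminf e" using e by (intro sum_le_suminf) auto
  finally show ?thesis using nonneg[of n] by simp
qed

text \<open>The Toeplitz--Cesaro theorem for weighted means.\<close>

lemma weighted_means_tendsto:
  fixes w c :: "nat \<Rightarrow> real"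
  assumes w: "\<And>k. 0 < w k" and W: "filterlim (\<lambda>n. \<Sum>k<n. w k) at_top sequentially"
    and c: "c \<longlonglongrightarrow> l"
  shows "(\<lambda>n. (\<Sum>k<n. w k * c k) / (\<Sum>k<n. w k)) \<longlonglongrightarrow> l"
proof (rule LIMSEQ_I)
  fix r :: real assume "r > 0"
  define W where "W n = (\<Sum>k<n. w k)" for n
  have W_pos: "W n > 0" if "n > 0" for n unfolding W_def using w that by (intro sum_pos) auto
  obtain N where N: "\<And>n. n \<ge> N \<Longrightarrow> \<bar>c n - l\<bar> < r / 2"
    using LIMSEQ_D[OF c, of "r / 2"] \<open>r > 0\<close> by auto
  define M where "M = (\<Sum>k<N. w k * \<bar>c k - l\<bar>)"
  have "\<forall>\<^sub>F n in sequentially. W n > 2 * M / r"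
    using W unfolding W_def filterlim_at_top_dense by blast
  then obtain N' where N': "\<And>n. n \<ge> N' \<Longrightarrow> W n > 2 * M / r" by (auto simp: eventually_sequentially)
  show "\<exists>no. \<forall>n\<ge>no. norm ((\<Sum>k<n. w k * c k) / (\<Sum>k<n. w k) - l) < r"
  proof (intro exI allI impI)
    fix n assume n: "max (max N N') 1 \<le> n"
    have "\<bar>(\<Sum>k<n. w k * c k) - l * W n\<bar> = \<bar>\<Sum>k<n. w k * (c k - l)\<bar>"
      by (simp add: W_def sum_subtractf sum_distrib_left algebra_simps)
    also have "\<dots> \<le> (\<Sum>k<n. w k * \<bar>c k - l\<bar>)"
      using w by (intro order_trans[OF sum_abs] sum_mono) (simp add: abs_mult abs_of_pos)
    also have "\<dots> = M + (\<Sum>k\<in>{N..<n}. w k * \<bar>c k - l\<bar>)"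
      unfolding M_def using n by (simp add: lessThan_atLeast0 sum.atLeastLessThan_concat)
    also have "(\<Sum>k\<in>{N..<n}. w k * \<bar>c k - l\<bar>) \<le> (\<Sum>k\<in>{N..<n}. w k * (r / 2))"
      using w N by (intro sum_mono mult_left_mono) (auto intro: less_imp_le)
    also have "\<dots> \<le> (\<Sum>k<n. w k * (r / 2))"
      using w \<open>r > 0\<close> by (intro sum_mono2) (auto intro: less_imp_le)
    also have "\<dots> = W n * r / 2" by (simp add: W_def sum_distrib_right sum_divide_distrib)
    finally have "\<bar>(\<Sum>k<n. w k * c k) - l * W n\<bar> \<le> M + W n * r / 2" by simp
    also have "M < W n * r / 2" using N'[of n] n \<open>r > 0\<close> by (simp add: field_simps)
    finally have "\<bar>(\<Sum>k<n. w k * c k) - l * W n\<bar> < r * W n" by simp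
    moreover have "(\<Sum>k<n. w k * c k) / W n - l = ((\<Sum>k<n. w k * c k) - l * W n) / W n"
      using W_pos[of n] n by (simp add: field_simps)
    ultimately show "norm ((\<Sum>k<n. w k * c k) / (\<Sum>k<n. w k) - l) < r"
      using W_pos[of n] n by (simp add: divide_less_eq flip: W_def)
  qed
qed

lemma partial_sums_at_top:
  fixes w :: "nat \<Rightarrow> real"
  assumes w: "\<And>k. 0 < w k" and sum: "(\<Sum>k. ereal (w k)) = \<infinity>"
  shows "filterlim (\<lambda>n. \<Sum>k<n. w k) at_top sequentially"
proof (rule ccontr)
  assume "\<not> ?thesis"
  then obtain B where B: "\<exists>\<^sub>F n in sequentially. (\<Sum>k<n. w k) \<le> B"
    unfolding filterlim_at_top_dense by (auto simp: not_eventually not_less)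
  have "(\<Sum>k<n. w k) \<le> B" for n
  proof -
    obtain m where "m \<ge> n" "(\<Sum>k<m. w k) \<le> B" using B by (auto simp: frequently_sequentially)
    moreover have "(\<Sum>k<n. w k) \<le> (\<Sum>k<m. w k)"
      using \<open>m \<ge> n\<close> w by (intro sum_mono2) (auto intro: less_imp_le)
    ultimately show ?thesis by simp
  qed
  then have "summable w"
    using w by (intro bounded_imp_summable[of w B]) (auto intro: less_imp_le simp only: lessThan_Suc_atMost[symmetric])
  then show False using sum suminf_ereal_finite by blast
qed

section \<open>Ergodic convergence to zeros of a maximal monotone operator\<close>

text \<open>The hypothesis says that adding \<open>0\<close> to the values at \<open>q\<close> keeps \<open>T\<close> monotone, so maximality puts
  \<open>0\<close> there already.\<close>

lemma maximal_monotone_zeroI: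
  assumes "maximal_monotone T" and q: "\<And>u w. w \<in> T u \<Longrightarrow> inner w (q - u) \<le> 0"
  shows "0 \<in> T q"
proof -
  define B where "B = T(q := insert 0 (T q))"
  have mono: "monotone_op T" using assms(1) by (simp add: maximal_monotone_def)
  have "monotone_op B"
    unfolding monotone_op_def
  proof (intro allI ballI)
    fix x y u v assume uv: "u \<in> B x" "v \<in> B y"
    consider "u \<in> T x" "v \<in> T y" | "x = q" "u = 0" "v \<in> T y" | "y = q" "v = 0" "u \<in> T x"
      | "x = q" "y = q" "u = 0" "v = 0"
      using uv by (auto simp: B_def split: if_splits)
    then show "0 \<le> inner (x - y) (u - v)"
    proof cases
      case 1 then show ?thesis using mono by (auto simp: monotone_op_def)
    next
      case 2 then show ?thesis using q[of v y] by (simp add: inner_commute)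
    next
      case 3 then show ?thesis using q[of u x] by (simp add: inner_simps inner_commute)
    qed simp
  qed
  moreover have "\<forall>x. T x \<subseteq> B x" by (auto simp: B_def)
  ultimately have "B = T" using assms(1) unfolding maximal_monotone_def by blast
  then show ?thesis by (metis B_def fun_upd_same insertI1)
qed

text \<open>Passty's ergodic principle. The energy inequality at the zeros of \<open>T\<close> (\<open>w = 0\<close>) controls distances
  and hence the uniqueness of cluster points of the averages; at the other pairs of the graph it
  shows, after summation, that these cluster points are zeros.\<close>

lemma passty_ergodic_convergence:
  fixes y :: "nat \<Rightarrow> 'a::{real_inner,complete_space}" and l :: "nat \<Rightarrow> real"
  assumes T: "maximal_monotone T" "zeros T \<noteq> {}"
    and l: "\<And>k. 0 < l k" "filterlim (\<lambda>n. \<Sum>k<n. l k) at_top sequentially"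
    and energy: "\<And>u w. w \<in> T u \<Longrightarrow> \<exists>e. summable e \<and> (\<forall>n. 0 \<le> e n) \<and>
      (\<forall>n. (norm (y (Suc n) - u))\<^sup>2 + 2 * l n * inner w (y (Suc n) - u) \<le> (norm (y n - u))\<^sup>2 + e n)"
  shows "\<exists>p\<in>zeros T.
    weakly_converges (\<lambda>n. (1 / (\<Sum>k<n. l k)) *\<^sub>R (\<Sum>k<n. l k *\<^sub>R y (Suc k))) p"
proof -
  define W where "W n = (\<Sum>k<n. l k)" for n
  have W_top: "filterlim W at_top sequentially" using l(2) by (simp add: W_def[abs_def])
  have W_pos: "W n > 0" if "n \<ge> 1" for n
    unfolding W_def using l(1) that by (intro sum_pos) (auto simp: lessThan_empty_iff)
  define Z where "Z n = (1 / W n) *\<^sub>R (\<Sum>k<n. l k *\<^sub>R y (Suc k))" for n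
  have Z_inner: "inner (Z n) v = (\<Sum>k<n. l k * inner (y (Suc k)) v) / W n" for n v
    by (simp add: Z_def inner_sum_left)

  have distance_convergent: "convergent (\<lambda>n. (norm (y n - u))\<^sup>2)" if "u \<in> zeros T" for u
  proof -
    have "0 \<in> T u" using that by (simp add: zeros_def)
    from energy[OF this] obtain e where e: "summable e" "\<And>n. 0 \<le> e n"
      and step: "\<And>n. (norm (y (Suc n) - u))\<^sup>2 \<le> (norm (y n - u))\<^sup>2 + e n" by auto
    show ?thesis by (rule quasi_decreasing_bounded_convergent[OF step _ e]) simp
  qed

  obtain B where B: "\<And>n. norm (y n) \<le> B"
  proof -
    obtain s where s: "s \<in> zeros T" using T(2) by blast
    have "Bseq (\<lambda>n. (norm (y n - s))\<^sup>2)"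
      by (intro convergent_imp_Bseq distance_convergent s)
    then obtain K where K: "\<And>n. (norm (y n - s))\<^sup>2 \<le> K"
      by (auto simp: Bseq_def)
    have "norm (y n) \<le> sqrt K + norm s" for n
      using real_le_rsqrt[OF K[of n]] norm_triangle_sub[of "y n" s] by linarith
    then show ?thesis using that by blast
  qed
  have "norm (Z n) \<le> B" for n
  proof (cases "n \<ge> 1")
    case True
    have "norm (\<Sum>k<n. l k *\<^sub>R y (Suc k)) \<le> (\<Sum>k<n. l k * B)"
      using l(1) B by (intro sum_norm_le) (simp add: abs_of_pos)
    also have "\<dots> = W n * B" by (simp add: W_def sum_distrib_right)
    finally show ?thesis using W_pos[OF True] by (simp add: Z_def field_simps)
  next
    case False
    then have "n = 0" by simp
    then show ?thesis using order_trans[OF norm_ge_zero B] by (simp add: Z_def)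
  qed
  then have Z_bounded: "bounded (range Z)" by (auto simp: bounded_iff)

  have Z_cluster: "q \<in> zeros T"
    if q: "\<And>v b. (\<forall>\<^sub>F n in sequentially. inner (Z n) v \<le> b) \<Longrightarrow> inner q v \<le> b" for q
  proof -
    have "inner w (q - u) \<le> 0" if w: "w \<in> T u" for u w
    proof -
      from energy[OF w] obtain e where e: "summable e" "\<And>n. 0 \<le> e n"
        and step: "\<And>n. (norm (y (Suc n) - u))\<^sup>2 + 2 * l n * inner w (y (Suc n) - u)
          \<le> (norm (y n - u))\<^sup>2 + e n" by blast
      define K where "K = (norm (y 0 - u))\<^sup>2 + suminf e"
      have "(\<Sum>k<n. 2 * l k * inner w (y (Suc k) - u)) \<le> K" for n
        unfolding K_def
        by (rule telescoping_partial_sums_bounded[of "\<lambda>n. (norm (y n - u))\<^sup>2", OF step _ e]) simp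
      moreover have "(\<Sum>k<n. 2 * l k * inner w (y (Suc k) - u))
          = 2 * ((\<Sum>k<n. l k * inner (y (Suc k)) w) - inner w u * W n)" for n
        by (simp add: W_def sum_distrib_left sum_subtractf inner_diff_right inner_commute algebra_simps)
      ultimately have bound: "2 * ((\<Sum>k<n. l k * inner (y (Suc k)) w) - inner w u * W n) \<le> K" for n
        by simp
      have Z_le: "inner (Z n) w \<le> inner w u + (K / 2) / W n" if "n \<ge> 1" for n
        using bound[of n] W_pos[OF that] by (simp add: Z_inner field_simps)
      have "inner q w \<le> inner w u"
      proof (rule field_le_epsilon)
        fix \<epsilon> :: real assume "\<epsilon> > 0"
        have "(\<lambda>n. (K / 2) / W n) \<longlonglongrightarrow> 0"
          by (rule tendsto_divide_0[OF tendsto_const filterlim_at_top_imp_at_infinity[OF W_top]])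
        then have "\<forall>\<^sub>F n in sequentially. (K / 2) / W n < \<epsilon>"
          using \<open>\<epsilon> > 0\<close> by (intro order_tendstoD) auto
        then have "\<forall>\<^sub>F n in sequentially. inner (Z n) w \<le> inner w u + \<epsilon>"
          using eventually_ge_at_top[of 1]
          by eventually_elim (use Z_le in fastforce)
        then show "inner q w \<le> inner w u + \<epsilon>" by (rule q)
      qed
      then show ?thesis by (simp add: inner_diff_right inner_commute)
    qed
    then show ?thesis using maximal_monotone_zeroI[OF T(1)] by (auto simp: zeros_def)
  qed

  have Z_inner_convergent: "convergent (\<lambda>n. inner (Z n) (q - r))"
    if qr: "q \<in> zeros T" "r \<in> zeros T" for q r
  proof -
    obtain a b where lims: "(\<lambda>n. (norm (y n - r))\<^sup>2) \<longlonglongrightarrow> a" "(\<lambda>n. (norm (y n - q))\<^sup>2) \<longlonglongrightarrow> b"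
      using distance_convergent qr unfolding convergent_def by blast
    have "(\<lambda>n. ((norm (y n - r))\<^sup>2 - (norm (y n - q))\<^sup>2 + (norm q)\<^sup>2 - (norm r)\<^sup>2) / 2)
        \<longlonglongrightarrow> (a - b + (norm q)\<^sup>2 - (norm r)\<^sup>2) / 2"
      by (intro tendsto_intros lims) simp
    moreover have "((norm (y n - r))\<^sup>2 - (norm (y n - q))\<^sup>2 + (norm q)\<^sup>2 - (norm r)\<^sup>2) / 2
        = inner (y n) (q - r)" for n
      unfolding power2_norm_eq_inner
      by (simp add: inner_diff_left inner_diff_right inner_commute field_simps)
    ultimately have "(\<lambda>n. inner (y n) (q - r)) \<longlonglongrightarrow> (a - b + (norm q)\<^sup>2 - (norm r)\<^sup>2) / 2"
      by simp
    then have "(\<lambda>n. inner (y (Suc n)) (q - r)) \<longlonglongrightarrow> (a - b + (norm q)\<^sup>2 - (norm r)\<^sup>2) / 2"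
      by (rule LIMSEQ_Suc)
    from weighted_means_tendsto[of l, OF l this]
    show ?thesis unfolding Z_inner W_def convergent_def by blast
  qed

  show ?thesis
    using weak_convergence_opial[OF Z_bounded Z_cluster Z_inner_convergent]
    by (simp add: Z_def[abs_def] W_def)
qed

section \<open>One step of the penalized forward-backward iteration\<close>

lemma normal_cone_scaleR: "p \<in> normal_cone C u \<Longrightarrow> 0 \<le> t \<Longrightarrow> t *\<^sub>R p \<in> normal_cone C u"
  by (auto simp: normal_cone_def mult_nonneg_nonpos split: if_splits)

lemma support_fun_normal_cone:
  assumes "p \<in> normal_cone C u"
  shows "support_fun C p = ereal (inner p u)"
  unfolding support_fun_def
proof (rule antisym)
  have u: "u \<in> C" and p: "\<And>c. c \<in> C \<Longrightarrow> inner p (c - u) \<le> 0"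
    using assms by (auto simp: normal_cone_def split: if_splits)
  show "(SUP c\<in>C. ereal (inner p c)) \<le> ereal (inner p u)"
    using p by (intro SUP_least) (simp add: inner_diff_right)
  show "ereal (inner p u) \<le> (SUP c\<in>C. ereal (inner p c))"
    using u by (rule SUP_upper)
qed

text \<open>The Fenchel--Young inequality at \<open>y\<close>, with the support function evaluated at the normal vector \<open>p\<close>.
  For \<open>y = u\<close> and \<open>F u = 0\<close> it also shows that the gap is nonnegative.\<close>

lemma conjugate_gap_lower_bound:
  assumes "p \<in> normal_cone C u" "F y = ereal r"
  shows "ereal (inner p (y - u) - r) \<le> fenchel_conj F p - support_fun C p"
proof -
  have "ereal (inner y p) - F y \<le> fenchel_conj F p"
    unfolding fenchel_conj_def by (rule SUP_upper) simp
  then have "ereal (inner p y - r) - ereal (inner p u) \<le> fenchel_conj F p - support_fun C p"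
    unfolding support_fun_normal_cone[OF assms(1)]
    using assms(2) by (intro ereal_minus_mono) (simp_all add: inner_commute)
  then show ?thesis by (simp add: inner_diff_right algebra_simps)
qed

text \<open>The factor \<open>L\<close> is kept in the conclusion because for \<open>L = 0\<close> the \<open>w n\<close> are not restricted at all.\<close>

lemma lipschitz_tendsto_zero:
  fixes w :: "nat \<Rightarrow> real"
  assumes L: "0 \<le> L" and sum: "(\<Sum>n. ereal (L * (w n)\<^sup>2)) < \<infinity>"
  shows "(\<lambda>n. L * w n) \<longlonglongrightarrow> 0"
proof -
  have "summable (\<lambda>n. L * (w n)\<^sup>2)" using sum L by (intro summable_ereal) auto
  then have "(\<lambda>n. L * (L * (w n)\<^sup>2)) \<longlonglongrightarrow> L * 0"
    by (intro tendsto_mult_left summable_LIMSEQ_zero)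
  then have "(\<lambda>n. (L * w n)\<^sup>2) \<longlonglongrightarrow> 0" by (simp add: power2_eq_square mult_ac)
  then show ?thesis by (simp add: power_tendsto_0_iff)
qed

text \<open>The strict inequality below 2 is turned into the fraction \<open>\<theta>\<close> of the penalty that a step can spare:
  if \<open>0 < c < 2\<close> and \<open>c\<close> eventually bounds \<open>r\<close>, then \<open>\<theta> = (2 - c) / 4\<close> works.\<close>

lemma penalty_margin:
  fixes r :: "nat \<Rightarrow> real"
  assumes nonneg: "\<And>n. 0 \<le> r n" and lim: "limsup (\<lambda>n. ereal (r n)) < 2"
  shows "\<exists>\<theta>>0. \<theta> \<le> 1 \<and> (\<forall>\<^sub>F n in sequentially. (1 + \<theta>) * r n / 2 \<le> 1 - \<theta>)"
proof -
  obtain c' where c': "limsup (\<lambda>n. ereal (r n)) < c'" "c' < 2" using dense[OF lim] by blast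
  then have ev: "\<forall>\<^sub>F n in sequentially. ereal (r n) < c'" by (intro Limsup_lessD)
  then obtain n where "ereal (r n) < c'" by (auto simp: eventually_sequentially)
  then have "0 < c'" using nonneg[of n] by (meson ereal_less_eq(5) le_less_trans)
  then obtain c where c: "c' = ereal c" "0 < c" "c < 2" using \<open>c' < 2\<close> by (cases c') auto
  define \<theta> where "\<theta> = (2 - c) / 4"
  have "2 * (1 - \<theta>) - (1 + \<theta>) * c = (2 - c)\<^sup>2 / 4"
    by (simp add: \<theta>_def power2_eq_square field_simps)
  moreover have "(2 - c)\<^sup>2 / 4 \<ge> 0" by simp
  ultimately have margin: "(1 + \<theta>) * c \<le> 2 * (1 - \<theta>)" by linarith
  have "\<forall>\<^sub>F n in sequentially. (1 + \<theta>) * r n / 2 \<le> 1 - \<theta>"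
    using ev
  proof (rule eventually_mono)
    fix n assume "ereal (r n) < c'"
    then have "(1 + \<theta>) * r n \<le> (1 + \<theta>) * c" using c by (intro mult_left_mono) (auto simp: \<theta>_def)
    then show "(1 + \<theta>) * r n / 2 \<le> 1 - \<theta>"
      using order_trans[OF _ margin, of "(1 + \<theta>) * r n"] by simp
  qed
  moreover have "0 < \<theta>" "\<theta> \<le> 1" using c by (auto simp: \<theta>_def)
  ultimately show ?thesis by blast
qed

text \<open>The term with \<open>\<nabla>\<Psi>1\<close> is estimated in two ways. The descent lemma produces \<open>-\<Psi>1 y\<close>
  but costs \<open>L\<Psi>1 / 2\<close> times the squared increment, which the increment term of the
  expansion of \<open>\<parallel>y - u\<parallel>\<^sup>2\<close> can pay only for \<open>L\<Psi>1 * l * b \<le> 1\<close>; cocoercivity costs only half as much,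
  so it reaches up to 2, but produces no penalty. The convex combination with weights \<open>\<theta>\<close> and
  \<open>1 - \<theta>\<close> does both. A further \<open>\<theta> / 2\<close> of the squared increment pays for the forward step in \<open>\<Phi>\<close>,
  and \<open>\<theta> / 2\<close> remains.\<close>

lemma forward_backward_penalty_step:
  fixes A :: "'a::{real_inner,complete_space} \<Rightarrow> 'a set"
    and \<Phi> \<Psi>1 :: "'a \<Rightarrow> real" and \<Psi>2 :: "'a \<Rightarrow> ereal"
  assumes A: "monotone_op A"
    and Phi: "convex_on UNIV \<Phi>" "\<And>y. \<Phi> differentiable (at y)" "L\<Phi>-lipschitz_on UNIV (gradient \<Phi>)"
    and Psi1: "convex_on UNIV \<Psi>1" "\<And>y. \<Psi>1 differentiable (at y)" "L\<Psi>1-lipschitz_on UNIV (gradient \<Psi>1)"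
    and nonneg: "\<And>y. 0 \<le> \<Psi>1 y" "\<And>y. 0 \<le> \<Psi>2 y"
    and u: "\<Psi>1 u = 0" "\<Psi>2 u = 0" "v \<in> A u"
    and step: "(x - y) /\<^sub>R l - gradient \<Phi> x - b *\<^sub>R gradient \<Psi>1 x
      \<in> A y + (\<lambda>v. b *\<^sub>R v) ` subdifferential \<Psi>2 y"
    and l: "l > 0" and b: "b > 0" and th: "0 < \<theta>" "\<theta> \<le> 1"
    and small: "(1 + \<theta>) * (L\<Psi>1 * l * b) / 2 \<le> 1 - \<theta>" "L\<Phi> * l \<le> \<theta>"
  shows "\<exists>r. \<Psi>2 y = ereal r \<and>
    (norm (y - u))\<^sup>2 + \<theta> / 2 * (norm (x - y))\<^sup>2 + 2 * \<theta> * l * b * (\<Psi>1 y + r)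
      \<le> (norm (x - u))\<^sup>2 + 2 * l * inner (v + gradient \<Phi> u) (u - y)"
proof -
  define N where "N = (norm (x - y))\<^sup>2"
  obtain a s where a: "a \<in> A y" and s: "s \<in> subdifferential \<Psi>2 y"
    and eq: "(x - y) /\<^sub>R l - gradient \<Phi> x - b *\<^sub>R gradient \<Psi>1 x = a + b *\<^sub>R s"
    using step by (auto elim!: set_plus_elim)
  have "l *\<^sub>R ((x - y) /\<^sub>R l) = l *\<^sub>R (gradient \<Phi> x + b *\<^sub>R gradient \<Psi>1 x + a + b *\<^sub>R s)"
    using eq by (simp add: algebra_simps)
  then have xy: "x - y = l *\<^sub>R (gradient \<Phi> x + b *\<^sub>R gradient \<Psi>1 x + a + b *\<^sub>R s)"
    using l by simp
  have s_u: "\<Psi>2 y + ereal (inner s (u - y)) \<le> 0"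
    using s u(2) unfolding subdifferential_def by (metis (mono_tags, lifting) mem_Collect_eq)
  then obtain r where r: "\<Psi>2 y = ereal r" using nonneg(2)[of y] by (cases "\<Psi>2 y") auto
  have r0: "0 \<le> r" and s_le: "inner s (u - y) \<le> - r"
    using s_u nonneg(2)[of y] by (auto simp: r zero_ereal_def)
  have a_le: "inner a (u - y) \<le> inner v (u - y)"
    using A a u(3) unfolding monotone_op_def by (fastforce simp: inner_simps inner_commute)
  have Phi_le: "inner (gradient \<Phi> x) (u - y) \<le> inner (gradient \<Phi> u) (u - y) + L\<Phi> / 4 * N"
    using gradient_three_point[OF Phi, of x u y] by (simp add: N_def inner_diff_left)
  have Psi1_le: "inner (gradient \<Psi>1 x) (u - y) \<le> - \<theta> * \<Psi>1 y + (1 + \<theta>) / 4 * L\<Psi>1 * N"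
  proof -
    have "gradient \<Psi>1 u = 0" using Psi1(2) nonneg(1) u(1) by (intro minimizer_gradient_zero) auto
    then have coco: "inner (gradient \<Psi>1 x) (u - y) \<le> L\<Psi>1 / 4 * N"
      using gradient_three_point[OF Psi1, of x u y] by (simp add: N_def)
    have "\<Psi>1 x + inner (gradient \<Psi>1 x) (u - x) \<le> 0"
      using convex_gradient_inequality[OF Psi1(1,2), of x u] u(1) by simp
    moreover have "\<Psi>1 y \<le> \<Psi>1 x + inner (gradient \<Psi>1 x) (y - x) + L\<Psi>1 / 2 * N"
      using descent_lemma[OF Psi1(2,3), of y x] by (simp add: N_def norm_minus_commute)
    ultimately have desc: "inner (gradient \<Psi>1 x) (u - y) \<le> - \<Psi>1 y + L\<Psi>1 / 2 * N"
      by (simp add: inner_diff_right)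
    have "inner (gradient \<Psi>1 x) (u - y)
        = \<theta> * inner (gradient \<Psi>1 x) (u - y) + (1 - \<theta>) * inner (gradient \<Psi>1 x) (u - y)"
      by (simp add: left_diff_distrib)
    also have "\<theta> * inner (gradient \<Psi>1 x) (u - y) + (1 - \<theta>) * inner (gradient \<Psi>1 x) (u - y)
        \<le> \<theta> * (- \<Psi>1 y + L\<Psi>1 / 2 * N) + (1 - \<theta>) * (L\<Psi>1 / 4 * N)"
      using th by (intro add_mono mult_left_mono desc coco) auto
    also have "\<dots> = - \<theta> * \<Psi>1 y + (1 + \<theta>) / 4 * L\<Psi>1 * N" by (simp add: field_simps)
    finally show ?thesis .
  qed
  have "(norm (y - u))\<^sup>2 + N - (norm (x - u))\<^sup>2 = 2 * inner (x - y) (u - y)"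
    unfolding N_def power2_norm_eq_inner by (simp add: inner_diff_left inner_diff_right inner_commute)
  also have "\<dots> = 2 * l * inner (gradient \<Phi> x) (u - y) + 2 * l * b * inner (gradient \<Psi>1 x) (u - y)
      + 2 * l * inner a (u - y) + 2 * l * b * inner s (u - y)"
    unfolding xy by (simp add: inner_add_left algebra_simps)
  also have "\<dots> \<le> 2 * l * (inner (gradient \<Phi> u) (u - y) + L\<Phi> / 4 * N)
      + 2 * l * b * (- \<theta> * \<Psi>1 y + (1 + \<theta>) / 4 * L\<Psi>1 * N)
      + 2 * l * inner v (u - y) + 2 * l * b * (- \<theta> * r)"
  proof (intro add_mono mult_left_mono Phi_le Psi1_le a_le)
    have "\<theta> * r \<le> 1 * r" using th r0 by (intro mult_right_mono) auto
    then show "inner s (u - y) \<le> - \<theta> * r" using s_le by simp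
  qed (use l b in auto)
  also have "\<dots> = 2 * l * inner (v + gradient \<Phi> u) (u - y) - 2 * \<theta> * l * b * (\<Psi>1 y + r)
      + (L\<Phi> * l / 2 + (1 + \<theta>) * (L\<Psi>1 * l * b) / 2) * N"
    by (simp add: inner_add_left algebra_simps)
  also have "\<dots> \<le> 2 * l * inner (v + gradient \<Phi> u) (u - y) - 2 * \<theta> * l * b * (\<Psi>1 y + r)
      + (\<theta> / 2 + (1 - \<theta>)) * N"
    using small by (intro add_left_mono mult_right_mono add_mono) (auto simp: N_def)
  finally have "(norm (y - u))\<^sup>2 + \<theta> / 2 * N + 2 * \<theta> * l * b * (\<Psi>1 y + r)
      \<le> (norm (x - u))\<^sup>2 + 2 * l * inner (v + gradient \<Phi> u) (u - y)"
    by (simp add: algebra_simps)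
  then show ?thesis using r unfolding N_def by blast
qed

section \<open>Weak convergence of the averages\<close>

theorem theorem1:
  fixes A :: "'a::{real_inner,complete_space} \<Rightarrow> 'a set"
    and \<Phi> \<Psi>1 :: "'a \<Rightarrow> real"
    and \<Psi>2 :: "'a \<Rightarrow> ereal"
    and C S :: "'a set"
    and T :: "'a \<Rightarrow> 'a set"
    and L\<Phi> L\<Psi>1 :: real
    and lam \<beta> \<tau> :: "nat \<Rightarrow> real"
    and x z zhat :: "nat \<Rightarrow> 'a"
  assumes A: "maximal_monotone A"
    and Phi: "convex_on UNIV \<Phi>" "\<And>y. \<Phi> differentiable (at y)"
    and Psi1: "convex_on UNIV \<Psi>1" "\<And>y. \<Psi>1 differentiable (at y)"
    and Psi2: "proper_fun \<Psi>2" "lsc_fun \<Psi>2" "convex_ereal \<Psi>2"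
    and min: "has_min \<Psi>1 0" "has_min \<Psi>2 0"
    and C: "C = Argmin \<Psi>1 \<inter> Argmin \<Psi>2" "C \<noteq> {}"
    and lam_pos: "\<And>n. n \<ge> 1 \<Longrightarrow> lam n > 0"
    and beta_pos: "\<And>n. n \<ge> 1 \<Longrightarrow> \<beta> n > 0"
    and T: "T = (\<lambda>y. A y + {gradient \<Phi> y} + normal_cone C y)" "maximal_monotone T"
    and S: "S = zeros T" "S \<noteq> {}"
    and lipschitz: "L\<Phi>-lipschitz_on UNIV (gradient \<Phi>)" "L\<Psi>1-lipschitz_on UNIV (gradient \<Psi>1)"
    and conj_summable: "\<And>p. p \<in> (\<Union>y. normal_cone C y) \<Longrightarrow>
       (\<Sum>n. ereal (lam (Suc n) * \<beta> (Suc n)) *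
          (fenchel_conj (\<lambda>y. ereal (\<Psi>1 y) + \<Psi>2 y) (p /\<^sub>R \<beta> (Suc n))
           - support_fun C (p /\<^sub>R \<beta> (Suc n)))) < \<infinity>"
    and lam_sum: "(\<Sum>n. ereal (lam (Suc n))) = \<infinity>"
    and lam_sq_sum: "(\<Sum>n. ereal (L\<Phi> * (lam (Suc n))\<^sup>2)) < \<infinity>"
    and lam_beta: "limsup (\<lambda>n. ereal (L\<Psi>1 * lam n * \<beta> n)) < 2"
    and SFBP: "SFBP_sequence A \<Phi> \<Psi>1 \<Psi>2 lam \<beta> x"
    and tau: "\<And>n. n \<ge> 1 \<Longrightarrow> \<tau> n = (\<Sum>k=1..n. lam k)"
    and z: "\<And>n. n \<ge> 1 \<Longrightarrow> z n = (1 / \<tau> n) *\<^sub>R (\<Sum>k=1..n. lam k *\<^sub>R x k)"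
    and zhat: "\<And>n. n \<ge> 1 \<Longrightarrow> zhat n = (1 / \<tau> n) *\<^sub>R (\<Sum>k=1..n. lam k *\<^sub>R x (k + 1))"
  shows "(\<exists>p\<in>S. weakly_converges zhat p) \<and>
         (summable (\<lambda>n. (lam (Suc n))\<^sup>2) \<longrightarrow> (\<exists>p\<in>S. weakly_converges z p))"
proof -
  note monoA = A[unfolded maximal_monotone_def, THEN conjunct1]
  have psi1_nonneg: "0 \<le> \<Psi>1 y" and psi2_nonneg: "0 \<le> \<Psi>2 y" for y
    using min by (simp_all add: has_min_def)
  have zero_on_C: "\<Psi>1 u = 0 \<and> \<Psi>2 u = 0" if "u \<in> C" for u
  proof -
    obtain a b where ab: "\<Psi>1 a = 0" "\<Psi>2 b = 0"
      using min unfolding has_min_def by (metis imageE)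
    have "\<Psi>1 u \<le> \<Psi>1 a" "\<Psi>2 u \<le> \<Psi>2 b" using that unfolding C(1) Argmin_def by blast+
    then have "\<Psi>1 u \<le> 0" "\<Psi>2 u \<le> 0" unfolding ab by simp_all
    then show ?thesis using psi1_nonneg[of u] psi2_nonneg[of u] by (simp add: antisym)
  qed

  define W where "W n = (\<Sum>k<n. lam (Suc k))" for n
  have lamS: "lam (Suc k) > 0" for k using lam_pos by simp
  have tau_W: "\<tau> n = W n" if "n \<ge> 1" for n
    using tau[OF that] by (simp add: W_def sum.atLeast1_atMost_eq)
  have W_pos: "W n > 0" if "n \<ge> 1" for n unfolding W_def using lamS that by (intro sum_pos) (auto simp: lessThan_empty_iff)
  have W_top: "filterlim W at_top sequentially"
    unfolding W_def[abs_def] by (rule partial_sums_at_top[OF lamS lam_sum])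

  obtain \<theta> where th: "0 < \<theta>" "\<theta> \<le> 1"
    and th_step: "\<forall>\<^sub>F n in sequentially. (1 + \<theta>) * (L\<Psi>1 * lam (Suc n) * \<beta> (Suc n)) / 2 \<le> 1 - \<theta>"
  proof -
    have "0 \<le> L\<Psi>1 * lam (Suc n) * \<beta> (Suc n)" for n
      using lipschitz_on_nonneg[OF lipschitz(2)] lam_pos[of "Suc n"] beta_pos[of "Suc n"] by simp
    moreover have "limsup (\<lambda>n. ereal (L\<Psi>1 * lam (Suc n) * \<beta> (Suc n))) < 2"
      using lam_beta limsup_shift[of "\<lambda>n. ereal (L\<Psi>1 * lam n * \<beta> n)"] by simp
    ultimately show ?thesis using penalty_margin[of "\<lambda>n. L\<Psi>1 * lam (Suc n) * \<beta> (Suc n)"] that by blast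
  qed
  have small_step: "\<forall>\<^sub>F n in sequentially. L\<Phi> * lam (Suc n) \<le> \<theta>"
  proof -
    have "\<forall>\<^sub>F n in sequentially. L\<Phi> * lam (Suc n) < \<theta>"
      using lipschitz_tendsto_zero[OF lipschitz_on_nonneg[OF lipschitz(1)] lam_sq_sum] th(1)
      by (intro order_tendstoD) auto
    then show ?thesis by (rule eventually_mono) simp
  qed

  have energy: "\<exists>e. summable e \<and> (\<forall>n. 0 \<le> e n) \<and>
      (\<forall>n. (norm (x (Suc (Suc n)) - u))\<^sup>2
          + (\<theta> / 2 * (norm (x (Suc n) - x (Suc (Suc n))))\<^sup>2
             + 2 * lam (Suc n) * inner w (x (Suc (Suc n)) - u))
        \<le> (norm (x (Suc n) - u))\<^sup>2 + e n)"
    if wT: "w \<in> T u" for u w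
  proof -
    obtain v p where v: "v \<in> A u" and p: "p \<in> normal_cone C u" and w: "w = v + gradient \<Phi> u + p"
      using wT unfolding T(1) by (auto simp: set_plus_def)
    have u: "u \<in> C" using p by (auto simp: normal_cone_def split: if_splits)
    define F where "F = (\<lambda>y. ereal (\<Psi>1 y) + \<Psi>2 y)"
    define q where "q = p /\<^sub>R \<theta>"
    define gap where "gap n = fenchel_conj F (q /\<^sub>R \<beta> (Suc n)) - support_fun C (q /\<^sub>R \<beta> (Suc n))" for n
    define g where "g n = ereal (lam (Suc n) * \<beta> (Suc n)) * gap n" for n
    have q: "q \<in> normal_cone C u" unfolding q_def using p th by (intro normal_cone_scaleR) auto
    have lb: "lam (Suc n) * \<beta> (Suc n) > 0" for n
      using lam_pos[of "Suc n"] beta_pos[of "Suc n"] by simp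
    have gap_ge: "ereal (inner (q /\<^sub>R \<beta> (Suc n)) (y - u) - r) \<le> gap n" if "F y = ereal r" for n y r
      unfolding gap_def using q beta_pos[of "Suc n"] that
      by (intro conjugate_gap_lower_bound[of _ C u] normal_cone_scaleR) (auto intro: less_imp_le)
    \<comment> \<open>Nonnegativity matters twice: the given series may be summed termwise, and the errors are nonnegative.\<close>
    have "0 \<le> gap n" for n
      using gap_ge[of u 0 n] zero_on_C[OF u] by (simp add: F_def zero_ereal_def)
    then have g_nonneg: "0 \<le> g n" for n unfolding g_def using lb[of n] by simp
    have g_fin: "(\<Sum>n. g n) \<noteq> \<infinity>"
      using conj_summable[of q] q unfolding g_def gap_def F_def by auto
    define G where "G n = real_of_ereal (g n)" for n
    have G: "summable G" unfolding G_def by (rule summable_real_of_ereal[OF g_nonneg g_fin])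
    have G_nonneg: "0 \<le> G n" for n unfolding G_def using g_nonneg by (simp add: real_of_ereal_pos)
    have gG: "g n = ereal (G n)" for n
      unfolding G_def using suminf_PInfty[OF g_nonneg g_fin, of n] g_nonneg[of n]
      by (cases "g n") auto
    \<comment> \<open>The penalty comes with the factor \<open>\<theta>\<close> only, which is why the gap is taken at \<open>q = p / \<theta>\<close> rather than \<open>p\<close>.\<close>
    have "\<forall>\<^sub>F n in sequentially.
        (norm (x (Suc (Suc n)) - u))\<^sup>2
          + (\<theta> / 2 * (norm (x (Suc n) - x (Suc (Suc n))))\<^sup>2
             + 2 * lam (Suc n) * inner w (x (Suc (Suc n)) - u))
        \<le> (norm (x (Suc n) - u))\<^sup>2 + 2 * \<theta> * G n"
      using th_step small_step
    proof eventually_elim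
      case (elim n)
      let ?x = "x (Suc n)" and ?y = "x (Suc (Suc n))" and ?l = "lam (Suc n)" and ?b = "\<beta> (Suc n)"
      have iter: "(?x - ?y) /\<^sub>R ?l - gradient \<Phi> ?x - ?b *\<^sub>R gradient \<Psi>1 ?x
          \<in> A ?y + (\<lambda>v. ?b *\<^sub>R v) ` subdifferential \<Psi>2 ?y"
        using SFBP unfolding SFBP_sequence_def by (metis Suc_eq_plus1 le_add2)
      obtain r where r: "\<Psi>2 ?y = ereal r" and
        step: "(norm (?y - u))\<^sup>2 + \<theta> / 2 * (norm (?x - ?y))\<^sup>2 + 2 * \<theta> * ?l * ?b * (\<Psi>1 ?y + r)
          \<le> (norm (?x - u))\<^sup>2 + 2 * ?l * inner (v + gradient \<Phi> u) (u - ?y)"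
        using forward_backward_penalty_step[where ?\<Psi>2.0 = \<Psi>2,
            OF monoA Phi lipschitz(1) Psi1 lipschitz(2) psi1_nonneg psi2_nonneg
              zero_on_C[OF u, THEN conjunct1] zero_on_C[OF u, THEN conjunct2] v iter
              lamS beta_pos th elim] by auto
      have "ereal (inner (q /\<^sub>R ?b) (?y - u) - (\<Psi>1 ?y + r)) \<le> gap n"
        using r by (intro gap_ge) (simp add: F_def)
      then have "ereal (?l * ?b) * ereal (inner (q /\<^sub>R ?b) (?y - u) - (\<Psi>1 ?y + r)) \<le> g n"
        unfolding g_def using lb[of n] by (intro ereal_mult_left_mono) auto
      then have "?l * ?b * (inner (q /\<^sub>R ?b) (?y - u) - (\<Psi>1 ?y + r)) \<le> G n"
        by (simp add: gG)
      then have "2 * \<theta> * (?l * ?b * (inner (q /\<^sub>R ?b) (?y - u) - (\<Psi>1 ?y + r))) \<le> 2 * \<theta> * G n"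
        using th by (intro mult_left_mono) auto
      moreover have "2 * \<theta> * (?l * ?b * (inner (q /\<^sub>R ?b) (?y - u) - (\<Psi>1 ?y + r)))
          = 2 * ?l * inner p (?y - u) - 2 * \<theta> * ?l * ?b * (\<Psi>1 ?y + r)"
        using beta_pos[of "Suc n"] th by (simp add: q_def right_diff_distrib) (simp add: field_simps)
      moreover have "2 * ?l * inner w (?y - u)
          = 2 * ?l * inner p (?y - u) - 2 * ?l * inner (v + gradient \<Phi> u) (u - ?y)"
        by (simp add: w inner_add_left inner_diff_right algebra_simps)
      ultimately show ?case using step by linarith
    qed
    from summable_error_everywhere[OF this] G G_nonneg th show ?thesis by auto
  qed

  have energy_T: "\<exists>e. summable e \<and> (\<forall>n. 0 \<le> e n) \<and>
      (\<forall>n. (norm (x (Suc (Suc n)) - u))\<^sup>2 + 2 * lam (Suc n) * inner w (x (Suc (Suc n)) - u)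
        \<le> (norm (x (Suc n) - u))\<^sup>2 + e n)"
    if w: "w \<in> T u" for u w
  proof -
    from energy[OF w] obtain e where e: "summable e" "\<And>n. 0 \<le> e n"
      and step: "\<And>n. (norm (x (Suc (Suc n)) - u))\<^sup>2
          + (\<theta> / 2 * (norm (x (Suc n) - x (Suc (Suc n))))\<^sup>2
             + 2 * lam (Suc n) * inner w (x (Suc (Suc n)) - u))
        \<le> (norm (x (Suc n) - u))\<^sup>2 + e n" by blast
    have "(norm (x (Suc (Suc n)) - u))\<^sup>2 + 2 * lam (Suc n) * inner w (x (Suc (Suc n)) - u)
        \<le> (norm (x (Suc n) - u))\<^sup>2 + e n" for n
    proof -
      have "0 \<le> \<theta> / 2 * (norm (x (Suc n) - x (Suc (Suc n))))\<^sup>2" using th by simp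
      then show ?thesis using step[of n] by linarith
    qed
    then show ?thesis using e by blast
  qed
  define Z where "Z n = (1 / W n) *\<^sub>R (\<Sum>k<n. lam (Suc k) *\<^sub>R x (Suc (Suc k)))" for n
  obtain p where p: "p \<in> S" and Z_lim: "weakly_converges Z p"
    using passty_ergodic_convergence[of T "\<lambda>k. lam (Suc k)" "\<lambda>k. x (Suc k)",
        OF T(2) S(2)[unfolded S(1)] lamS W_top[unfolded W_def[abs_def]] energy_T]
    by (auto simp: S(1) Z_def[abs_def] W_def)

  obtain D where D: "\<And>n. (\<Sum>k<n. (norm (x (Suc k) - x (Suc (Suc k))))\<^sup>2) \<le> D"
  proof -
    obtain s where "s \<in> S" using S(2) by blast
    then have "0 \<in> T s" by (simp add: S(1) zeros_def)
    from energy[OF this] obtain e where e: "summable e" "\<And>n. 0 \<le> e n"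
      and step: "\<And>n. (norm (x (Suc (Suc n)) - s))\<^sup>2 + \<theta> / 2 * (norm (x (Suc n) - x (Suc (Suc n))))\<^sup>2
        \<le> (norm (x (Suc n) - s))\<^sup>2 + e n" by auto
    have "\<theta> / 2 * (\<Sum>k<n. (norm (x (Suc k) - x (Suc (Suc k))))\<^sup>2)
        \<le> (norm (x (Suc 0) - s))\<^sup>2 + suminf e" for n
      using telescoping_partial_sums_bounded[of "\<lambda>n. (norm (x (Suc n) - s))\<^sup>2", OF step _ e]
      by (simp add: sum_distrib_left)
    then have "(\<Sum>k<n. (norm (x (Suc k) - x (Suc (Suc k))))\<^sup>2)
        \<le> ((norm (x (Suc 0) - s))\<^sup>2 + suminf e) * 2 / \<theta>" for n
      using th by (simp add: field_simps)
    then show ?thesis using that by blast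
  qed
  have zhat_Z: "zhat n = Z n" if "n \<ge> 1" for n
    using zhat[OF that] tau_W[OF that] by (simp add: Z_def sum.atLeast1_atMost_eq)
  have zhat_lim: "weakly_converges zhat p"
  proof (rule weakly_converges_norm_close[OF Z_lim])
    have "\<forall>\<^sub>F n in sequentially. zhat n - Z n = 0"
      using eventually_ge_at_top[of 1] by eventually_elim (simp add: zhat_Z)
    then show "(\<lambda>n. zhat n - Z n) \<longlonglongrightarrow> 0" by (rule tendsto_eventually)
  qed
  have z_lim: "weakly_converges z p" if sq: "summable (\<lambda>n. (lam (Suc n))\<^sup>2)"
  proof -
    \<comment> \<open>Half the sum of the squares of the step sizes and of the increments bounds \<open>\<Sum> \<lambda>\<^sub>k \<parallel>x\<^sub>k - x\<^sub>k\<^sub>+\<^sub>1\<parallel>\<close>.\<close>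
    define K where "K = (suminf (\<lambda>n. (lam (Suc n))\<^sup>2) + D) / 2"
    have close: "norm (z n - Z n) \<le> K / W n" if "n \<ge> 1" for n
    proof -
      have "z n - Z n = (1 / W n) *\<^sub>R (\<Sum>k<n. lam (Suc k) *\<^sub>R (x (Suc k) - x (Suc (Suc k))))"
        using z[OF that] tau_W[OF that]
        by (simp add: Z_def sum.atLeast1_atMost_eq sum_subtractf scaleR_diff_right)
      moreover have "norm (\<Sum>k<n. lam (Suc k) *\<^sub>R (x (Suc k) - x (Suc (Suc k)))) \<le> K"
      proof -
        have "norm (\<Sum>k<n. lam (Suc k) *\<^sub>R (x (Suc k) - x (Suc (Suc k))))
            \<le> (\<Sum>k<n. ((lam (Suc k))\<^sup>2 + (norm (x (Suc k) - x (Suc (Suc k))))\<^sup>2) / 2)"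
        proof (rule sum_norm_le)
          fix k
          have "0 \<le> (lam (Suc k) - norm (x (Suc k) - x (Suc (Suc k))))\<^sup>2" by simp
          then show "norm (lam (Suc k) *\<^sub>R (x (Suc k) - x (Suc (Suc k))))
              \<le> ((lam (Suc k))\<^sup>2 + (norm (x (Suc k) - x (Suc (Suc k))))\<^sup>2) / 2"
            using lamS[of k] by (simp add: power2_diff abs_of_pos)
        qed
        also have "\<dots> = ((\<Sum>k<n. (lam (Suc k))\<^sup>2) + (\<Sum>k<n. (norm (x (Suc k) - x (Suc (Suc k))))\<^sup>2)) / 2"
          by (simp add: sum.distrib flip: sum_divide_distrib)
        also have "\<dots> \<le> K"
          unfolding K_def using D[of n] sum_le_suminf[OF sq, of "{..<n}"] by simp
        finally show ?thesis .
      qed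
      ultimately show ?thesis using W_pos[OF that] by (simp add: divide_right_mono)
    qed
    have "(\<lambda>n. K / W n) \<longlonglongrightarrow> 0"
      by (rule tendsto_divide_0[OF tendsto_const filterlim_at_top_imp_at_infinity[OF W_top]])
    moreover have "\<forall>\<^sub>F n in sequentially. norm (z n - Z n) \<le> K / W n"
      using eventually_ge_at_top[of 1] by eventually_elim (rule close)
    ultimately have "(\<lambda>n. z n - Z n) \<longlonglongrightarrow> 0" by (rule Lim_null_comparison[rotated])
    then show ?thesis by (rule weakly_converges_norm_close[OF Z_lim])
  qed
  show ?thesis by (intro conjI impI bexI[OF _ p] zhat_lim z_lim)
qed

end
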